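(* Let $\Bbbk$ be an algebraically closed field and let $f = \sum_i c_i \mathbf{x}^{\mathbf{a}_i}$ be a nonzero polynomial in $\Bbbk[x_1,\ldots,x_n]$, a finite sum in which all $c_i \in \Bbbk$ are nonzero and the exponent vectors $\mathbf{a}_i \in \mathbb{Z}_{\geq 0}^n$ are pairwise distinct. Then $f$ is well-poised if and only if $f$ is disjointly supported and $\gcd(\mathbf{a}_i,\mathbf{a}_j) = 1$ for every pair of distinct indices $i \neq j$.
   Context: For $\mathbf{a} = (a_1,\ldots,a_n) \in \mathbb{Z}_{\geq 0}^n$ write $\mathbf{x}^{\mathbf{a}} = x_1^{a_1}\cdots x_n^{a_n}$. For $\boldsymbol\omega \in \mathbb{R}^n$, the initial form $in_{\boldsymbol\omega}(f)$ is the sum of those terms $c_i\mathbf{x}^{\mathbf{a}_i}$ of $f$ for which the inner product $\langle \boldsymbol\omega, \mathbf{a}_i\rangle$ is maximal among all terms of $f$. The polynomial $f$ is well-poised if every initial form $in_{\boldsymbol\omega}(f)$, $\boldsymbol\omega \in \mathbb{R}^n$, which is not a monomial (i.e. which has at least two terms) is irreducible in $\Bbbk[x_1,\ldots,x_n]$. The support of a monomial is $supp(\mathbf{x}^{\mathbf{a}}) = \{j : a_j \neq 0\}$. The polynomial $f$ is disjointly supported if $supp(\mathbf{x}^{\mathbf{a}_i}) \cap supp(\mathbf{x}^{\mathbf{a}_j}) = \varnothing$ for any two distinct terms $i \neq j$ of $f$. For two exponent vectors, $\gcd(\mathbf{a}_i,\mathbf{a}_j)$ denotes the greatest common divisor of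 all entries of both vectors taken together. *)

theory Defs
  imports "HOL-Analysis.Analysis"
    "HOL-Library.Poly_Mapping"
    "HOL-Computational_Algebra.Computational_Algebra"
begin

text \<open>
  Polynomials are finitely supported maps from exponent vectors to coefficients, with the
  convolution product of \<open>HOL-Library.Poly_Mapping\<close>. The variables are indexed by a finite
  type \<open>'n\<close>, so \<open>CARD('n)\<close> is the number of variables and the polynomial ring is a whole
  type; \<^const>\<open>irreducible\<close> on it is irreducibility in that ring. The terms of \<open>f\<close> are
  indexed by \<open>keys f\<close>, and the support of the monomial with exponent \<open>a\<close> is \<open>keys a\<close>.
\<close>

type_synonym 'n expvec = "'n \<Rightarrow>\<^sub>0 nat"

type_synonym ('n, 'k) mpoly = "'n expvec \<Rightarrow>\<^sub>0 'k"

definition weight :: "real ^ 'n \<Rightarrow> 'n::finite expvec \<Rightarrow> real" where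
  "weight w a = w \<bullet> (\<chi> j. real (Poly_Mapping.lookup a j))"

definition initial_form :: "real ^ 'n \<Rightarrow> ('n::finite, 'k::field) mpoly \<Rightarrow> ('n, 'k) mpoly" where
  "initial_form w f =
     (\<Sum>a \<in> {a \<in> Poly_Mapping.keys f. \<forall>b \<in> Poly_Mapping.keys f. weight w b \<le> weight w a}.
        Poly_Mapping.single a (Poly_Mapping.lookup f a))"

definition well_poised :: "('n::finite, 'k::field) mpoly \<Rightarrow> bool" where
  "well_poised f \<longleftrightarrow>
     (\<forall>w :: real ^ 'n. card (Poly_Mapping.keys (initial_form w f)) \<ge> 2 \<longrightarrow>
        irreducible (initial_form w f))"

definition disjointly_supported :: "('n::finite, 'k::field) mpoly \<Rightarrow> bool" where
  "disjointly_supported f \<longleftrightarrow>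
     (\<forall>a \<in> Poly_Mapping.keys f. \<forall>b \<in> Poly_Mapping.keys f. a \<noteq> b \<longrightarrow>
        Poly_Mapping.keys a \<inter> Poly_Mapping.keys b = {})"

definition gcd_expvec :: "'n::finite expvec \<Rightarrow> 'n expvec \<Rightarrow> nat" where
  "gcd_expvec a b = Gcd (range (Poly_Mapping.lookup a) \<union> range (Poly_Mapping.lookup b))"

end

theory Submission
  imports Defs
begin

text \<open>
  Weight degrees \<open>max {weight w a | a \<in> keys f}\<close> add up under multiplication. If the terms of \<open>f = g h\<close> are disjointly supported, then weights that are constant on
  the terms of \<open>f\<close> are constant on those of \<open>g\<close>; this forces the exponents of \<open>g\<close> to be
  combinations of the exponents of \<open>f\<close>, and coprimality makes the coefficients integral. The degree
  giving weight \<open>1\<close> to each nonconstant term of \<open>f\<close> is then a sum of two natural numbers, so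
  one factor is constant. Conversely, by induction on the number of terms, for a well-poised \<open>f\<close> the
  unique terms of top degree in the single variables are disjointly supported and every exponent is
  a convex combination of them and possibly \<open>0\<close>. An irreducible form supported on a segment has
  an endpoint gcd of \<open>1\<close>, since binary forms over an algebraically closed field split; the same
  integrality argument then excludes further exponents.
\<close>

unbundle no fps_syntax

abbreviation "lookup \<equiv> Poly_Mapping.lookup"
abbreviation "keys \<equiv> Poly_Mapping.keys"

subsection \<open>Weights and products\<close>

definition exponent_vector :: "'n::finite expvec \<Rightarrow> real ^ 'n" where
  "exponent_vector a = (\<chi> j. real (lookup a j))"

lemma exponent_vector_nth [simp]: "exponent_vector a $ j = real (lookup a j)"
  by (simp add: exponent_vector_def)

lemma weight_eq_inner: "weight w a = w \<bullet> exponent_vector a"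
  by (simp add: weight_def exponent_vector_def)

lemma inj_exponent_vector: "inj exponent_vector"
  by (rule injI) (auto intro!: poly_mapping_eqI simp: vec_eq_iff)

lemma weight_add_right: "weight w (a + b) = weight w a + weight w b"
  by (simp add: weight_def inner_vec_def lookup_add algebra_simps sum.distrib)

lemma weight_zero_right [simp]: "weight w 0 = 0"
  by (simp add: weight_def inner_vec_def)

lemma weight_uminus [simp]: "weight (- w) a = - weight w a"
  by (simp add: weight_def)

lemma weight_add_left: "weight (v + w) a = weight v a + weight w a"
  by (simp add: weight_def inner_add_left)

lemma weight_diff_left: "weight (v - w) a = weight v a - weight w a"
  by (simp add: weight_def inner_diff_left)

lemma weight_scaleR_left: "weight (r *\<^sub>R w) a = r * weight w a"
  by (simp add: weight_def)

lemma weight_sum_left: "weight (\<Sum>i\<in>A. w i) a = (\<Sum>i\<in>A. weight (w i) a)"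
  by (simp add: weight_def inner_sum_left)

lemma weight_axis [simp]: "weight (axis j r) a = r * real (lookup a j)"
  by (simp add: weight_def inner_axis')

text \<open>The weights that fail to separate two given exponents form a hyperplane. Finitely many
  hyperplanes are negligible together, so some weight avoids them all.\<close>

lemma ex_injective_weight:
  fixes A :: "'n::finite expvec set"
  assumes "finite A"
  shows "\<exists>u. inj_on (weight u) A"
proof -
  define D where "D = (\<lambda>(a, b). exponent_vector a - exponent_vector b) ` {(a, b). a \<in> A \<and> b \<in> A \<and> a \<noteq> b}"
  have "finite {(a, b). a \<in> A \<and> b \<in> A \<and> a \<noteq> b}"
    by (rule finite_subset[of _ "A \<times> A"]) (use assms in auto)
  hence "finite D"
    by (simp add: D_def)
  moreover have "negligible {x. d \<bullet> x = 0}" if "d \<in> D" for d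
    using that inj_exponent_vector
    by (intro negligible_hyperplane) (auto simp: D_def dest: injD)
  ultimately have "negligible (\<Union>d\<in>D. {x. d \<bullet> x = 0})"
    by auto
  hence "(\<Union>d\<in>D. {x. d \<bullet> x = 0}) \<noteq> UNIV"
    using non_negligible_UNIV by metis
  then obtain u where u: "\<And>d. d \<in> D \<Longrightarrow> d \<bullet> u \<noteq> 0"
    by blast
  have "inj_on (weight u) A"
  proof (rule inj_onI)
    fix a b assume ab: "a \<in> A" "b \<in> A" "weight u a = weight u b"
    show "a = b"
    proof (rule ccontr)
      assume "a \<noteq> b"
      with ab have "exponent_vector a - exponent_vector b \<in> D"
        by (auto simp: D_def)
      from u[OF this] ab(3) show False
        by (simp add: weight_eq_inner inner_diff_right inner_commute[of _ u])
    qed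
  qed
  thus ?thesis ..
qed

text \<open>When \<open>a + b\<close> splits into exponents of \<open>f\<close> and \<open>g\<close>
  in one way only, nothing can cancel in its coefficient.\<close>

lemma lookup_mult_unique:
  fixes f g :: "('n::finite, 'k::field) mpoly"
  assumes "\<And>a' b'. a' \<in> keys f \<Longrightarrow> b' \<in> keys g \<Longrightarrow> a' + b' = a + b \<Longrightarrow> a' = a"
  shows "lookup (f * g) (a + b) = lookup f a * lookup g b"
proof -
  have "lookup f l * Sum_any (\<lambda>q. lookup g q when a + b = l + q) =
      (lookup f a * lookup g b when l = a)" for l
  proof (cases "l = a")
    case True
    thus ?thesis by simp
  next
    case False
    have "lookup f l = 0 \<or> (lookup g q when a + b = l + q) = 0" for q
      using assms[of l q] False by (auto simp: in_keys_iff when_def dest: sym)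
    hence "lookup f l = 0 \<or> (\<lambda>q. lookup g q when a + b = l + q) = (\<lambda>q. 0)"
      by (auto simp: fun_eq_iff)
    hence "lookup f l = 0 \<or> Sum_any (\<lambda>q. lookup g q when a + b = l + q) = 0"
      by (elim disjE) (simp_all only: Sum_any.neutral simp_thms)
    thus ?thesis using False by auto
  qed
  thus ?thesis
    by (simp add: lookup_mult)
qed

lemma ex_in_keys: "f \<noteq> 0 \<Longrightarrow> \<exists>a. a \<in> keys f"
  by (metis keys_eq_empty ex_in_conv)

lemma two_elements:
  assumes "card A \<ge> 2"
  obtains a b where "a \<in> A" "b \<in> A" "a \<noteq> b"
proof -
  have "finite A" using assms by (intro card_ge_0_finite) simp
  with assms that show thesis
    using card_le_Suc0_iff_eq[of A] by auto
qed

section \<open>Weighted degrees and units\<close>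

definition wdeg :: "real ^ 'n \<Rightarrow> ('n::finite, 'k::field) mpoly \<Rightarrow> real" where
  "wdeg w f = Max (weight w ` keys f)"

lemma weight_le_wdeg: "a \<in> keys f \<Longrightarrow> weight w a \<le> wdeg w f"
  by (simp add: wdeg_def)

lemma wdeg_attained:
  assumes "f \<noteq> 0"
  obtains a where "a \<in> keys f" "weight w a = wdeg w f"
proof -
  have "wdeg w f \<in> weight w ` keys f"
    unfolding wdeg_def using assms by (intro Max_in) auto
  with that show thesis by auto
qed

lemma wdegI: "a \<in> keys f \<Longrightarrow> (\<And>b. b \<in> keys f \<Longrightarrow> weight w b \<le> weight w a) \<Longrightarrow> wdeg w f = weight w a"
  unfolding wdeg_def by (intro Max_eqI) auto

text \<open>The product of the leading terms survives because its exponent splits in only one way.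
  The first claim supplies the absence of zero divisors.\<close>

lemma wdeg_mult:
  fixes f g :: "('n::finite, 'k::field) mpoly"
  assumes f: "f \<noteq> 0" and g: "g \<noteq> 0"
  shows "f * g \<noteq> 0" "wdeg w (f * g) = wdeg w f + wdeg w g"
proof -
  \<comment> \<open>Ties for the weight \<open>w\<close> are broken by a weight that is injective on all terms in sight.\<close>
  obtain u where u: "inj_on (weight u) (keys f \<union> keys g)"
    using ex_injective_weight[of "keys f \<union> keys g"] by auto
  define top where "top h = {a \<in> keys h. weight w a = wdeg w h}" for h :: "('n, 'k) mpoly"
  have "\<exists>a \<in> top h. \<forall>b \<in> top h. weight u b \<le> weight u a" if "h \<noteq> 0" for h
  proof -
    have "finite (top h)" by (simp add: top_def)
    moreover have "top h \<noteq> {}"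
      using wdeg_attained[OF that] by (auto simp: top_def)
    ultimately have "Max (weight u ` top h) \<in> weight u ` top h"
      by (intro Max_in) auto
    then obtain a where "a \<in> top h" "weight u a = Max (weight u ` top h)"
      by auto
    with \<open>finite (top h)\<close> show ?thesis
      by (intro bexI[of _ a]) auto
  qed
  then obtain a b where a: "a \<in> top f" "\<And>a'. a' \<in> top f \<Longrightarrow> weight u a' \<le> weight u a"
    and b: "b \<in> top g" "\<And>b'. b' \<in> top g \<Longrightarrow> weight u b' \<le> weight u b"
    using f g by metis
  have "a' = a" if "a' \<in> keys f" "b' \<in> keys g" "a' + b' = a + b" for a' b'
  proof -
    have "weight w a' + weight w b' = weight w a + weight w b"
      and *: "weight u a' + weight u b' = weight u a + weight u b"
      using that(3) by (metis weight_add_right)+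
    hence "a' \<in> top f" "b' \<in> top g"
      using that weight_le_wdeg[of a' f w] weight_le_wdeg[of b' g w] a(1) b(1)
      by (auto simp: top_def)
    with * a(2) b(2) have "weight u a' = weight u a" by force
    thus "a' = a"
      using u that(1) a(1) by (auto simp: top_def dest: inj_onD)
  qed
  hence "lookup (f * g) (a + b) = lookup f a * lookup g b"
    by (rule lookup_mult_unique)
  hence ab: "a + b \<in> keys (f * g)"
    using a(1) b(1) by (auto simp: top_def in_keys_iff)
  thus "f * g \<noteq> 0" by auto
  have "weight w c \<le> weight w (a + b)" if c: "c \<in> keys (f * g)" for c
  proof -
    obtain a' b' where "a' \<in> keys f" "b' \<in> keys g" "c = a' + b'"
      using c keys_mult[of f g] by blast
    thus ?thesis
      using weight_le_wdeg[of a' f w] weight_le_wdeg[of b' g w] a(1) b(1)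
      by (auto simp: weight_add_right top_def)
  qed
  with ab have "wdeg w (f * g) = weight w (a + b)"
    by (intro wdegI)
  thus "wdeg w (f * g) = wdeg w f + wdeg w g"
    using a(1) b(1) by (simp add: top_def weight_add_right)
qed

text \<open>In every single variable the degrees of two factors of \<open>1\<close> are nonnegative
  and add up to \<open>0\<close>. Conversely, a nonzero constant is inverted in the field.\<close>

lemma mpoly_dvd_one_iff:
  fixes f :: "('n::finite, 'k::field) mpoly"
  shows "f dvd 1 \<longleftrightarrow> f \<noteq> 0 \<and> keys f \<subseteq> {0}"
proof
  assume "f dvd 1"
  then obtain g where g: "1 = f * g" ..
  hence nz: "f \<noteq> 0" "g \<noteq> 0" by auto
  have "a = 0" if a: "a \<in> keys f" for a
  proof (rule poly_mapping_eqI)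
    fix j
    have "wdeg (axis j 1) (1 :: ('n, 'k) mpoly) = 0"
      by (simp add: wdeg_def)
    hence "wdeg (axis j 1) f + wdeg (axis j 1) g = 0"
      using wdeg_mult(2)[OF nz] g by metis
    moreover obtain b where "b \<in> keys g" "weight (axis j 1) b = wdeg (axis j 1) g"
      using wdeg_attained[OF nz(2)] .
    hence "0 \<le> wdeg (axis j 1) g"
      by (metis weight_axis mult_1 of_nat_0_le_iff)
    ultimately show "lookup a j = lookup 0 j"
      using weight_le_wdeg[OF a, of "axis j 1"] by simp
  qed
  with nz show "f \<noteq> 0 \<and> keys f \<subseteq> {0}" by auto
next
  assume f: "f \<noteq> 0 \<and> keys f \<subseteq> {0}"
  define c where "c = lookup f 0"
  have "f = Poly_Mapping.single 0 c"
    using f by (intro poly_mapping_eqI) (auto simp: c_def lookup_single when_def in_keys_iff)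
  moreover have "c \<noteq> 0"
    using f calculation by auto
  ultimately have "f * Poly_Mapping.single 0 (inverse c) = 1"
    by (simp add: mult_single)
  thus "f dvd 1" by (metis dvdI)
qed

subsection \<open>Integral combinations of coprime exponents\<close>

text \<open>By Bezout, the gcd is an integral combination of the elements of
  \<open>X\<close>.\<close>

lemma Ints_mult_Gcd:
  fixes t :: real and X :: "nat set"
  assumes "finite X" "\<And>x. x \<in> X \<Longrightarrow> t * real x \<in> \<int>"
  shows "t * real (Gcd X) \<in> \<int>"
  using assms
proof (induction X)
  case empty
  thus ?case by simp
next
  case (insert x X)
  obtain u v where uv: "u * int x + v * int (Gcd X) = gcd (int x) (int (Gcd X))"
    using bezout_int by blast
  have "real (Gcd (insert x X)) = real_of_int (gcd (int x) (int (Gcd X)))"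
    by (simp add: gcd_int_int_eq)
  also have "\<dots> = of_int u * real x + of_int v * real (Gcd X)"
    by (simp flip: uv del: gcd_int_int_eq)
  finally have "t * real (Gcd (insert x X)) = of_int u * (t * real x) + of_int v * (t * real (Gcd X))"
    by (simp add: algebra_simps)
  moreover have "t * real x \<in> \<int>" "t * real (Gcd X) \<in> \<int>"
    using insert by auto
  ultimately show ?case by simp
qed

definition exponent_gcd :: "'n::finite expvec \<Rightarrow> nat" where
  "exponent_gcd a = Gcd (range (lookup a))"

lemma gcd_expvec_eq: "gcd_expvec a b = gcd (exponent_gcd a) (exponent_gcd b)"
proof (rule dvd_antisym)
  show "gcd_expvec a b dvd gcd (exponent_gcd a) (exponent_gcd b)"
    unfolding gcd_expvec_def exponent_gcd_def by (intro gcd_greatest Gcd_greatest Gcd_dvd) auto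
  have "gcd (exponent_gcd a) (exponent_gcd b) dvd m"
    if "m \<in> range (lookup a) \<union> range (lookup b)" for m
  proof -
    have "exponent_gcd a dvd m \<or> exponent_gcd b dvd m"
      unfolding exponent_gcd_def using that by (auto intro: Gcd_dvd)
    thus ?thesis by (meson dvd_trans gcd_dvd1 gcd_dvd2)
  qed
  thus "gcd (exponent_gcd a) (exponent_gcd b) dvd gcd_expvec a b"
    unfolding gcd_expvec_def by (rule Gcd_greatest)
qed

lemma Ints_mult_exponent_gcd:
  fixes t :: real
  assumes "\<And>j. t * real (lookup a j) \<in> \<int>"
  shows "t * real (exponent_gcd a) \<in> \<int>"
  unfolding exponent_gcd_def using assms by (intro Ints_mult_Gcd) auto

text \<open>After multiplication by the product \<open>G\<close> of the gcds of the other exponents,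
  every other summand is integral, hence so is \<open>t a * G\<close>. Since
  \<open>t a * exponent_gcd a\<close> is integral too and the two multipliers are coprime,
  \<open>t a\<close> itself is integral.\<close>

lemma coprime_combination_Ints:
  fixes t :: "'n::finite expvec \<Rightarrow> real"
  assumes fin: "finite V"
    and coprime: "\<And>a b. a \<in> V \<Longrightarrow> b \<in> V \<Longrightarrow> a \<noteq> b \<Longrightarrow> gcd_expvec a b = 1"
    and int: "\<And>a j. a \<in> V \<Longrightarrow> t a * real (lookup a j) \<in> \<int>"
    and sum: "(\<Sum>a\<in>V. t a) \<in> \<int>"
    and a: "a \<in> V"
  shows "t a \<in> \<int>"
proof -
  define G where "G = (\<Prod>b\<in>V - {a}. exponent_gcd b)"
  have "t b * real G \<in> \<int>" if b: "b \<in> V - {a}" for b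
  proof -
    have "exponent_gcd b dvd G"
      unfolding G_def using b fin by (intro dvd_prodI) auto
    then obtain m where "G = exponent_gcd b * m" ..
    hence "t b * real G = (t b * real (exponent_gcd b)) * real m"
      by (simp del: mult_eq_0_iff mult_cancel_left)
    moreover have "t b * real (exponent_gcd b) \<in> \<int>"
      using b int by (intro Ints_mult_exponent_gcd) auto
    ultimately show ?thesis by (simp only: Ints_mult Ints_of_nat)
  qed
  hence "(\<Sum>b\<in>V - {a}. t b * real G) \<in> \<int>"
    by (intro Ints_sum)
  moreover have "t a * real G = (\<Sum>b\<in>V. t b) * real G - (\<Sum>b\<in>V - {a}. t b * real G)"
    using fin a by (simp add: sum.remove[of V a] distrib_right flip: sum_distrib_right)
  ultimately have "t a * real G \<in> \<int>"
    using sum by simp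
  moreover have "t a * real (exponent_gcd a) \<in> \<int>"
    using a int by (intro Ints_mult_exponent_gcd) auto
  ultimately have "t a * real (Gcd {exponent_gcd a, G}) \<in> \<int>"
    by (intro Ints_mult_Gcd) auto
  moreover have "coprime (exponent_gcd a) G"
    unfolding G_def using coprime a
    by (intro prod_coprime_right) (auto simp: gcd_expvec_eq coprime_iff_gcd_eq_1)
  ultimately show ?thesis
    by (simp add: coprime_iff_gcd_eq_1)
qed

section \<open>Coordinates along an exponent\<close>

definition index :: "'n::finite expvec \<Rightarrow> 'n" where
  "index a = (SOME j. lookup a j \<noteq> 0)"

lemma lookup_index: "a \<noteq> 0 \<Longrightarrow> lookup a (index a) \<noteq> 0"
  unfolding index_def by (rule someI_ex) (use ex_in_keys[of a] in \<open>simp add: in_keys_iff\<close>)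

text \<open>Once \<open>b\<close> is known to be proportional to \<open>a\<close> on the support of
  \<open>a\<close>, this is the factor of proportionality, read off at one coordinate.\<close>

definition ratio :: "'n::finite expvec \<Rightarrow> 'n expvec \<Rightarrow> real" where
  "ratio a b = real (lookup b (index a)) / real (lookup a (index a))"

lemma ratio_nonneg: "ratio a b \<ge> 0"
  by (simp add: ratio_def)

lemma ratio_self: "a \<noteq> 0 \<Longrightarrow> ratio a a = 1"
  using lookup_index[of a] by (simp add: ratio_def)

text \<open>Expresses the linear functional \<open>ratio a\<close> as a weight, so that facts about
  weighted degrees and faces apply to it.\<close>

definition ratio_weight :: "'n::finite expvec \<Rightarrow> real ^ 'n" where
  "ratio_weight a = axis (index a) (1 / real (lookup a (index a)))"

lemma weight_ratio_weight [simp]: "weight (ratio_weight a) b = ratio a b"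
  by (simp add: ratio_weight_def ratio_def)

subsection \<open>Irreducibility of coprime disjointly supported polynomials\<close>

locale coprime_disjoint_factorization =
  fixes f g h :: "('n::finite, 'k::field) mpoly"
  assumes f_eq: "f = g * h"
    and two_terms: "card (keys f) \<ge> 2"
    and disjoint: "disjointly_supported f"
    and coprime: "\<And>a b. a \<in> keys f \<Longrightarrow> b \<in> keys f \<Longrightarrow> a \<noteq> b \<Longrightarrow> gcd_expvec a b = 1"
begin

lemma swap: "coprime_disjoint_factorization f h g"
  using f_eq two_terms disjoint coprime
  by unfold_locales (auto simp: mult.commute)

lemma nonzero: "f \<noteq> 0" "g \<noteq> 0" "h \<noteq> 0"
  using two_terms f_eq by auto

lemma wdeg_f: "wdeg w f = wdeg w g + wdeg w h"
  using wdeg_mult(2)[OF nonzero(2,3)] f_eq by simp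

lemma lookup_eq_0:
  assumes "a \<in> keys f" "b \<in> keys f" "a \<noteq> b" "lookup a j \<noteq> 0"
  shows "lookup b j = 0"
  using disjoint assms unfolding disjointly_supported_def
  by (metis IntI empty_iff in_keys_iff)

text \<open>The spread between largest and smallest weight is additive over factors, by additivity
  of the degrees for \<open>w\<close> and \<open>- w\<close>. It is \<open>0\<close> for
  \<open>f\<close> and nonnegative for \<open>h\<close>, hence \<open>0\<close> for
  \<open>g\<close>.\<close>

lemma weight_constant_on_factor:
  assumes const: "\<And>a. a \<in> keys f \<Longrightarrow> weight w a = c" and "b \<in> keys g" "b' \<in> keys g"
  shows "weight w b = weight w b'"
proof -
  obtain a where "a \<in> keys f" using nonzero(1) ex_in_keys by blast
  hence "wdeg w f = c" "wdeg (- w) f = - c"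
    using const by (auto intro!: trans[OF wdegI[of a]])
  hence "wdeg w g + wdeg w h = c" "wdeg (- w) g + wdeg (- w) h = - c"
    by (simp_all add: wdeg_f)
  moreover obtain d where d: "d \<in> keys h" using nonzero(3) ex_in_keys by blast
  hence "weight w d \<le> wdeg w h" "- weight w d \<le> wdeg (- w) h"
    using weight_le_wdeg[OF d, of w] weight_le_wdeg[OF d, of "- w"] by auto
  moreover have "weight w b \<le> wdeg w g" "weight w b' \<le> wdeg w g"
    "- weight w b \<le> wdeg (- w) g" "- weight w b' \<le> wdeg (- w) g"
    using assms(2,3) weight_le_wdeg[of _ g w] weight_le_wdeg[of _ g "- w"] by force+
  ultimately show ?thesis by linarith
qed

text \<open>One of two disjointly supported terms omits the variable \<open>j\<close>, so the lowest
  \<open>j\<close>-degree of \<open>f\<close> is \<open>0\<close>; those of the two factors are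
  nonnegative and add up to it. The entry \<open>- 1\<close> turns lowest degrees into
  maxima.\<close>

lemma ex_lookup_eq_0: "\<exists>b\<in>keys g. lookup b j = 0"
proof -
  let ?w = "axis j (- 1) :: real ^ 'n"
  obtain a b where ab: "a \<in> keys f" "b \<in> keys f" "a \<noteq> b"
    using two_terms two_elements by metis
  then obtain c where "c \<in> keys f" "lookup c j = 0"
    using lookup_eq_0 by metis
  hence "wdeg ?w f = 0"
    by (subst wdegI[of c]) auto
  moreover obtain b where b: "b \<in> keys g" "weight ?w b = wdeg ?w g"
    using wdeg_attained[OF nonzero(2)] .
  moreover obtain d where "d \<in> keys h" "weight ?w d = wdeg ?w h"
    using wdeg_attained[OF nonzero(3)] .
  hence "wdeg ?w h \<le> 0" by simp
  ultimately have "lookup b j = 0"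
    using wdeg_f[of ?w] by simp
  with b(1) show ?thesis ..
qed

lemma lookup_outside_supports:
  assumes "\<And>a. a \<in> keys f \<Longrightarrow> lookup a j = 0" "b \<in> keys g"
  shows "lookup b j = 0"
proof -
  obtain b' where "b' \<in> keys g" "lookup b' j = 0"
    using ex_lookup_eq_0 by auto
  with weight_constant_on_factor[of "axis j 1" 0 b b'] assms show ?thesis by simp
qed

text \<open>The weight comparing the normalized coordinates \<open>i\<close> and \<open>j\<close> is
  \<open>0\<close> on all terms of \<open>f\<close>, hence constant on \<open>g\<close>. Exponents
  of \<open>g\<close> omitting \<open>i\<close> and \<open>j\<close> respectively bound this
  constant by \<open>0\<close> from above and below.\<close>

lemma lookup_proportional:
  assumes a: "a \<in> keys f" "lookup a i \<noteq> 0" "lookup a j \<noteq> 0" and b: "b \<in> keys g"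
  shows "real (lookup b i) / real (lookup a i) = real (lookup b j) / real (lookup a j)"
proof -
  define w :: "real ^ 'n" where "w = axis i (1 / real (lookup a i)) - axis j (1 / real (lookup a j))"
  have w: "weight w c = real (lookup c i) / real (lookup a i) - real (lookup c j) / real (lookup a j)" for c
    by (simp add: w_def weight_diff_left)
  have "weight w c = 0" if "c \<in> keys f" for c
    using that a lookup_eq_0[of a c] by (cases "c = a") (auto simp: w)
  note const = weight_constant_on_factor[of w, OF this]
  obtain b0 where "b0 \<in> keys g" "lookup b0 i = 0"
    using ex_lookup_eq_0 by auto
  hence "weight w b \<le> 0"
    using const[OF _ b, of b0] by (simp add: w)
  moreover obtain b1 where "b1 \<in> keys g" "lookup b1 j = 0"
    using ex_lookup_eq_0 by auto
  hence "weight w b \<ge> 0"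
    using const[OF _ b, of b1] by (simp add: w)
  ultimately show ?thesis by (simp add: w)
qed

lemma ratio_mult_lookup:
  assumes "a \<in> keys f" "b \<in> keys g"
  shows "ratio a b * real (lookup a j) = (if lookup a j = 0 then 0 else real (lookup b j))"
proof (cases "lookup a j = 0")
  case False
  hence "a \<noteq> 0" by auto
  thus ?thesis
    using lookup_proportional[OF assms(1) lookup_index False assms(2)] False
    by (simp add: ratio_def)
qed auto

definition total :: "real ^ 'n" where
  "total = (\<Sum>a\<in>keys f - {0}. ratio_weight a)"

lemma weight_total: "weight total b = (\<Sum>a\<in>keys f - {0}. ratio a b)"
  by (simp add: total_def weight_sum_left)

lemma weight_total_term:
  assumes "a \<in> keys f" "a \<noteq> 0"
  shows "weight total a = 1"
proof -
  have "ratio b a = (if b = a then 1 else 0)" if "b \<in> keys f - {0}" for b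
  proof -
    have "lookup b (index b) \<noteq> 0"
      using that by (intro lookup_index) simp
    thus ?thesis
      using that assms lookup_eq_0[of b a "index b"] by (cases "b = a") (simp_all add: ratio_def)
  qed
  hence "weight total a = (\<Sum>b\<in>keys f - {0}. if b = a then 1 else 0)"
    unfolding weight_total by (intro sum.cong) auto
  also have "\<dots> = 1"
    using assms by (subst sum.delta) auto
  finally show ?thesis .
qed

lemma ratio_Ints:
  assumes a: "a \<in> keys f" "a \<noteq> 0" and b: "b \<in> keys g"
  shows "ratio a b \<in> \<int>"
proof -
  \<comment> \<open>With this choice \<open>ratio a b0\<close> is \<open>0\<close>, so integrality
    of a difference of ratios gives integrality of \<open>ratio a b\<close>.\<close>
  obtain b0 where b0: "b0 \<in> keys g" "lookup b0 (index a) = 0"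
    using ex_lookup_eq_0 by auto
  \<comment> \<open>A constant term of \<open>f\<close> takes up the slack: its exponents are \<open>0\<close>, so any coefficient is admissible.\<close>
  define t where "t c = (if c = 0 then weight total b0 - weight total b else ratio c b - ratio c b0)" for c
  have "t a \<in> \<int>"
  proof (rule coprime_combination_Ints[OF finite_keys coprime])
    fix c j assume "c \<in> keys f"
    thus "t c * real (lookup c j) \<in> \<int>"
      using b b0 by (auto simp: t_def left_diff_distrib ratio_mult_lookup)
  next
    have *: "(\<Sum>c\<in>keys f - {0}. t c) = weight total b - weight total b0"
      by (simp add: t_def weight_total sum_subtractf)
    have "(\<Sum>c\<in>keys f. t c) = 0"
    proof (cases "0 \<in> keys f")
      case True
      thus ?thesis using * by (simp add: sum.remove t_def)
    next
      case False
      hence "weight total b = weight total b0"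
        using b b0 by (intro weight_constant_on_factor[of _ 1] weight_total_term) auto
      with * False show ?thesis by simp
    qed
    thus "(\<Sum>c\<in>keys f. t c) \<in> \<int>" by simp
  qed (use a in auto)
  thus ?thesis
    using a b0 by (simp add: t_def ratio_def)
qed

lemma wdeg_total: "wdeg total g \<in> \<int>" "wdeg total g \<ge> 0"
proof -
  obtain b where b: "b \<in> keys g" "weight total b = wdeg total g"
    using wdeg_attained[OF nonzero(2)] .
  have "weight total b \<in> \<int>"
    using ratio_Ints b(1) by (auto simp: weight_total intro!: Ints_sum)
  moreover have "weight total b \<ge> 0"
    by (auto simp: weight_total ratio_def intro!: sum_nonneg)
  ultimately show "wdeg total g \<in> \<int>" "wdeg total g \<ge> 0"
    by (simp_all only: b(2))
qed

text \<open>A vanishing sum of nonnegative ratios makes each ratio vanish, so an exponent of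
  \<open>g\<close> is \<open>0\<close> on the supports of the terms of \<open>f\<close>; elsewhere
  it is \<open>0\<close> anyway.\<close>

lemma unit_if_wdeg_total_eq_0:
  assumes "wdeg total g = 0"
  shows "g dvd 1"
proof -
  have "b = 0" if b: "b \<in> keys g" for b
  proof (rule poly_mapping_eqI)
    fix j
    have nonneg: "ratio a b \<ge> 0" for a by (simp add: ratio_def)
    have "weight total b \<le> 0"
      using weight_le_wdeg[OF b, of total] assms by simp
    moreover have "(\<Sum>a\<in>keys f - {0}. ratio a b) \<ge> 0"
      using nonneg by (intro sum_nonneg)
    ultimately have "(\<Sum>a\<in>keys f - {0}. ratio a b) = 0"
      by (simp add: weight_total)
    hence ratio: "\<And>a. a \<in> keys f \<Longrightarrow> a \<noteq> 0 \<Longrightarrow> ratio a b = 0"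
      using nonneg by (subst (asm) sum_nonneg_eq_0_iff) auto
    show "lookup b j = lookup 0 j"
    proof (cases "\<exists>a\<in>keys f. lookup a j \<noteq> 0")
      case True
      then obtain a where a: "a \<in> keys f" "lookup a j \<noteq> 0" by auto
      moreover from this have "a \<noteq> 0" by auto
      ultimately show ?thesis
        using ratio_mult_lookup[OF a(1) b, of j] ratio[OF a(1)] by simp
    next
      case False
      thus ?thesis using lookup_outside_supports[OF _ b, of j] by auto
    qed
  qed
  thus ?thesis
    using nonzero(2) by (auto simp: mpoly_dvd_one_iff)
qed

lemma wdeg_total_f: "wdeg total f = 1"
proof -
  obtain a where a: "a \<in> keys f" "a \<noteq> 0"
    using two_terms two_elements by metis
  have "weight total b \<le> 1" if "b \<in> keys f" for b
    using weight_total_term[OF that] by (cases "b = 0") auto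
  with a weight_total_term[OF a] show ?thesis
    by (subst wdegI[of a]) auto
qed

interpretation swapped: coprime_disjoint_factorization f h g
  by (rule swap)

lemma unit_factor: "g dvd 1 \<or> h dvd 1"
proof -
  \<comment> \<open>The weight \<open>total\<close> depends on \<open>f\<close> alone, so the
    swapped facts about \<open>h\<close> speak of the same weight.\<close>
  obtain m n :: int where mn: "wdeg total g = of_int m" "wdeg total h = of_int n"
    using wdeg_total(1) swapped.wdeg_total(1) by (auto elim!: Ints_cases)
  have "m \<ge> 0" "n \<ge> 0"
    using wdeg_total(2) swapped.wdeg_total(2) mn by auto
  moreover have "real_of_int (m + n) = 1"
    using wdeg_f[of total] wdeg_total_f mn by simp
  hence "m + n = 1" by linarith
  ultimately have "m = 0 \<or> n = 0" by linarith
  thus ?thesis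
    using unit_if_wdeg_total_eq_0 swapped.unit_if_wdeg_total_eq_0 mn by auto
qed

end

lemma irreducible_if_coprime_disjoint:
  fixes f :: "('n::finite, 'k::field) mpoly"
  assumes "card (keys f) \<ge> 2" "disjointly_supported f"
    and "\<And>a b. a \<in> keys f \<Longrightarrow> b \<in> keys f \<Longrightarrow> a \<noteq> b \<Longrightarrow> gcd_expvec a b = 1"
  shows "irreducible f"
proof (rule irreducibleI)
  show "f \<noteq> 0" using assms(1) by auto
  show "\<not> f dvd 1"
    using assms(1) card_mono[of "{0}" "keys f"] by (auto simp: mpoly_dvd_one_iff)
  fix g h assume "f = g * h"
  then interpret coprime_disjoint_factorization f g h
    using assms by unfold_locales auto
  show "g dvd 1 \<or> h dvd 1" by (rule unit_factor)
qed

subsection \<open>Faces of finite sets of exponents\<close>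

definition face :: "real ^ 'n \<Rightarrow> 'n::finite expvec set \<Rightarrow> 'n expvec set" where
  "face w K = {a \<in> K. \<forall>b\<in>K. weight w b \<le> weight w a}"

lemma face_subset: "face w K \<subseteq> K"
  by (auto simp: face_def)

lemma face_zero [simp]: "face 0 K = K"
  by (simp add: face_def weight_def)

lemma ex_maximal_value:
  fixes \<phi> :: "'a \<Rightarrow> real"
  assumes "finite A" "A \<noteq> {}"
  obtains a where "a \<in> A" "\<And>b. b \<in> A \<Longrightarrow> \<phi> b \<le> \<phi> a"
proof -
  have "Max (\<phi> ` A) \<in> \<phi> ` A"
    using assms by (intro Max_in) auto
  then obtain a where "a \<in> A" "\<phi> a = Max (\<phi> ` A)"
    by auto
  with assms(1) that[of a] show thesis by simp
qed

lemma face_nonempty: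
  assumes "finite K" "K \<noteq> {}"
  shows "face w K \<noteq> {}"
proof -
  obtain a where "a \<in> K" "\<And>b. b \<in> K \<Longrightarrow> weight w b \<le> weight w a"
    using ex_maximal_value[OF assms] by blast
  thus ?thesis by (auto simp: face_def)
qed

text \<open>For large \<open>N\<close> the weight \<open>N *\<^sub>R w + w'\<close> compares by
  \<open>w\<close> first and uses \<open>w'\<close> only to break ties. Finiteness of
  \<open>K\<close> makes one \<open>N\<close> work for all pairs.\<close>

lemma face_of_face:
  assumes "finite K"
  shows "\<exists>v. face w' (face w K) = face v K"
proof -
  have "\<forall>p\<in>K \<times> K. eventually (\<lambda>N. weight w (snd p) < weight w (fst p) \<longrightarrow>
      weight w' (snd p) - weight w' (fst p) < N * (weight w (fst p) - weight w (snd p))) at_top"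
  proof
    fix p assume "p \<in> K \<times> K"
    show "eventually (\<lambda>N. weight w (snd p) < weight w (fst p) \<longrightarrow>
      weight w' (snd p) - weight w' (fst p) < N * (weight w (fst p) - weight w (snd p))) at_top"
      using eventually_gt_at_top[of "(weight w' (snd p) - weight w' (fst p)) / (weight w (fst p) - weight w (snd p))"]
    proof eventually_elim
      case (elim N)
      show ?case
      proof
        assume "weight w (snd p) < weight w (fst p)"
        with elim show "weight w' (snd p) - weight w' (fst p) < N * (weight w (fst p) - weight w (snd p))"
          by (simp add: pos_divide_less_eq)
      qed
    qed
  qed
  hence "eventually (\<lambda>N. \<forall>p\<in>K \<times> K. weight w (snd p) < weight w (fst p) \<longrightarrow>
      weight w' (snd p) - weight w' (fst p) < N * (weight w (fst p) - weight w (snd p))) at_top"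
    using assms by (intro eventually_ball_finite) auto
  then obtain N where "\<forall>p\<in>K \<times> K. weight w (snd p) < weight w (fst p) \<longrightarrow>
      weight w' (snd p) - weight w' (fst p) < N * (weight w (fst p) - weight w (snd p))"
    using eventually_happens'[OF trivial_limit_at_top_linorder] by blast
  hence N: "weight w' b - weight w' a < N * (weight w a - weight w b)"
    if "a \<in> K" "b \<in> K" "weight w b < weight w a" for a b
    using that by force
  define v where "v = N *\<^sub>R w + w'"
  have v: "weight v a = N * weight w a + weight w' a" for a
    by (simp add: v_def weight_add_left weight_scaleR_left)
  have less: "weight v b < weight v a" if "a \<in> K" "b \<in> K" "weight w b < weight w a" for a b
    using N[OF that] by (simp add: v algebra_simps)
  have "x \<in> face v K" if "x \<in> face w' (face w K)" for x
  proof -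
    have x: "x \<in> K" "\<And>b. b \<in> K \<Longrightarrow> weight w b \<le> weight w x"
      "\<And>b. b \<in> face w K \<Longrightarrow> weight w' b \<le> weight w' x"
      using that by (auto simp: face_def)
    have "weight v b \<le> weight v x" if b: "b \<in> K" for b
    proof (cases "weight w b = weight w x")
      case True
      hence "b \<in> face w K" using x(1,2) b by (auto simp: face_def)
      from x(3)[OF this] show ?thesis by (simp add: v True)
    next
      case False
      thus ?thesis using less[OF x(1) b] x(2)[OF b] by simp
    qed
    thus ?thesis using x(1) by (simp add: face_def)
  qed
  moreover have "x \<in> face w' (face w K)" if "x \<in> face v K" for x
  proof -
    have x: "x \<in> K" "\<And>b. b \<in> K \<Longrightarrow> weight v b \<le> weight v x"
      using that by (auto simp: face_def)
    hence xw: "weight w b \<le> weight w x" if "b \<in> K" for b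
      using less[OF that x(1)] that by (meson leD leI)
    hence "x \<in> face w K" using x(1) by (simp add: face_def)
    moreover have "weight w' b \<le> weight w' x" if "b \<in> face w K" for b
    proof -
      have "b \<in> K" "weight w b = weight w x"
        using that x(1) xw by (auto simp: face_def intro: antisym)
      with x(2)[OF this(1)] show ?thesis by (simp add: v)
    qed
    ultimately show ?thesis unfolding face_def[of w'] by blast
  qed
  ultimately show ?thesis by blast
qed

section \<open>Combinatorial conditions on exponent sets\<close>

definition coprime_disjoint :: "'n::finite expvec set \<Rightarrow> bool" where
  "coprime_disjoint K \<longleftrightarrow>
     (\<forall>a\<in>K. \<forall>b\<in>K. a \<noteq> b \<longrightarrow> keys a \<inter> keys b = {} \<and> gcd_expvec a b = 1)"

text \<open>The two traces that irreducibility of the initial forms leaves on exponents alone: no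
  variable divides a form with at least two terms, and a form on a segment with disjointly supported
  endpoints has coprime endpoints. The rest of the converse is combinatorial.\<close>

definition well_poised_faces :: "'n::finite expvec set \<Rightarrow> bool" where
  "well_poised_faces K \<longleftrightarrow>
     (\<forall>w j. card (face w K) \<ge> 2 \<longrightarrow> (\<exists>a\<in>face w K. lookup a j = 0)) \<and>
     (\<forall>w. \<forall>p\<in>face w K. \<forall>q\<in>face w K. p \<noteq> q \<longrightarrow> keys p \<inter> keys q = {} \<longrightarrow>
        (\<forall>b\<in>face w K. \<exists>t\<in>{0..1}. exponent_vector b = (1 - t) *\<^sub>R exponent_vector p + t *\<^sub>R exponent_vector q) \<longrightarrow>
        gcd_expvec p q = 1)"

lemma well_poised_faces_face:
  assumes "finite K" "well_poised_faces K"
  shows "well_poised_faces (face w K)"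
proof -
  have "\<exists>v. face w' (face w K) = face v K" for w'
    using face_of_face[OF assms(1)] .
  then obtain v where "\<And>w'. face w' (face w K) = face (v w') K"
    by metis
  thus ?thesis
    using assms(2) by (simp add: well_poised_faces_def)
qed

lemma gcd_expvec_commute: "gcd_expvec a b = gcd_expvec b a"
  by (simp add: gcd_expvec_def Un_commute)

text \<open>The setting of the induction step: \<open>proper_faces\<close> is the induction
  hypothesis for faces with fewer elements.\<close>

locale well_poised_set =
  fixes K :: "'n::finite expvec set"
  assumes finite_K: "finite K"
    and two_elements_K: "card K \<ge> 2"
    and well_poised_K: "well_poised_faces K"
    and proper_faces: "\<And>w. face w K \<noteq> K \<Longrightarrow> coprime_disjoint (face w K)"
begin

lemma face_avoids_variable: "card (face w K) \<ge> 2 \<Longrightarrow> \<exists>a\<in>face w K. lookup a j = 0"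
  using well_poised_K by (simp add: well_poised_faces_def)

lemma gcd_edge:
  assumes "p \<in> face w K" "q \<in> face w K" "p \<noteq> q" "keys p \<inter> keys q = {}"
    "\<And>b. b \<in> face w K \<Longrightarrow>
      \<exists>t\<in>{0..1}. exponent_vector b = (1 - t) *\<^sub>R exponent_vector p + t *\<^sub>R exponent_vector q"
  shows "gcd_expvec p q = 1"
  using well_poised_K assms unfolding well_poised_faces_def by blast

lemma ex_lookup_eq_0: "\<exists>a\<in>K. lookup a j = 0"
  using face_avoids_variable[of 0] two_elements_K by simp

text \<open>Two maximizers of the \<open>j\<close>-th coordinate would form a face with at least two
  elements; one of its elements omits \<open>j\<close>, so the maximum would be \<open>0\<close>,
  contrary to \<open>b0\<close>.\<close>

lemma ex_top:
  assumes "b0 \<in> K" "lookup b0 j \<noteq> 0"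
  shows "\<exists>a. a \<in> K \<and> (\<forall>b\<in>K. b \<noteq> a \<longrightarrow> lookup b j < lookup a j)"
proof -
  let ?F = "face (axis j 1) K"
  obtain a where a: "a \<in> ?F"
    using face_nonempty[OF finite_K, of "axis j 1"] assms(1) by blast
  have uniq: "b = a" if b: "b \<in> ?F" for b
  proof (rule ccontr)
    assume "b \<noteq> a"
    have "finite ?F"
      using finite_K face_subset finite_subset by blast
    hence "card {a, b} \<le> card ?F"
      using a b by (intro card_mono) auto
    hence "card ?F \<ge> 2" using \<open>b \<noteq> a\<close> by simp
    then obtain c where "c \<in> ?F" "lookup c j = 0"
      using face_avoids_variable by blast
    with assms show False by (auto simp: face_def)
  qed
  have "lookup b j < lookup a j" if "b \<in> K" "b \<noteq> a" for b
  proof (rule ccontr)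
    assume "\<not> lookup b j < lookup a j"
    with a \<open>b \<in> K\<close> have "b \<in> ?F"
      by (auto simp: face_def intro: order_trans)
    with that(2) uniq show False by blast
  qed
  thus ?thesis using a face_subset by blast
qed

section \<open>Exponents of top degree in a single variable\<close>

definition top :: "'n \<Rightarrow> 'n expvec" where
  "top j = (SOME a. a \<in> K \<and> (\<forall>b\<in>K. b \<noteq> a \<longrightarrow> lookup b j < lookup a j))"

lemma top:
  assumes "b0 \<in> K" "lookup b0 j \<noteq> 0"
  shows "top j \<in> K" "\<And>b. b \<in> K \<Longrightarrow> b \<noteq> top j \<Longrightarrow> lookup b j < lookup (top j) j"
  using someI_ex[OF ex_top[OF assms]] unfolding top_def by blast+

lemma lookup_top:
  assumes "b \<in> K" "lookup b j \<noteq> 0"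
  shows "lookup (top j) j \<noteq> 0" "lookup b j \<le> lookup (top j) j"
proof -
  show "lookup b j \<le> lookup (top j) j"
    using top(2)[OF assms assms(1)] by (cases "b = top j") auto
  with assms(2) show "lookup (top j) j \<noteq> 0" by linarith
qed

text \<open>
  Geometrically, \<open>b\<close> lies in the convex hull of \<open>top j\<close> and the points with vanishing \<open>j\<close>-th
  coordinate. Otherwise some weight could be tilted in direction \<open>j\<close> until its face contains
  \<open>top j\<close> and a further point involving \<open>j\<close>, but no point with vanishing \<open>j\<close>-th coordinate.
\<close>

lemma weight_le_interpolation:
  fixes b j defines "\<mu> \<equiv> real (lookup b j) / real (lookup (top j) j)"
  assumes b: "b \<in> K" "lookup b j \<noteq> 0"
    and bound: "\<And>v. v \<in> K \<Longrightarrow> lookup v j = 0 \<Longrightarrow> weight w v \<le> B"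
  shows "weight w b \<le> \<mu> * weight w (top j) + (1 - \<mu>) * B"
proof (rule ccontr)
  define a where "a = top j"
  have a: "a \<in> K" "lookup a j > 0" "\<And>v. v \<in> K \<Longrightarrow> v \<noteq> a \<Longrightarrow> lookup v j < lookup a j"
    using top[OF b] lookup_top[OF b] by (auto simp: a_def)
  assume "\<not> weight w b \<le> \<mu> * weight w (top j) + (1 - \<mu>) * B"
  hence *: "weight w b > \<mu> * weight w a + (1 - \<mu>) * B"
    by (simp add: a_def)
  hence "b \<noteq> a" using a(2) by (auto simp: \<mu>_def a_def)
  \<comment> \<open>This tilt lowers or raises \<open>a\<close> to the level \<open>B\<close> and
    leaves exponents without \<open>j\<close> unchanged, while \<open>b\<close> still lies above
    \<open>B\<close>.\<close>
  define u where "u = w + axis j ((B - weight w a) / real (lookup a j))"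
  have u: "weight u v = weight w v + (B - weight w a) / real (lookup a j) * real (lookup v j)" for v
    by (simp add: u_def weight_add_left)
  have ua: "weight u a = B" using a(2) by (simp add: u)
  have ub: "weight u b > B" using * by (simp add: u \<mu>_def a_def algebra_simps diff_divide_distrib)
  \<comment> \<open>The further tilt in direction \<open>j\<close> at which \<open>v\<close> and
    \<open>a\<close> get equal weight. At the largest such value \<open>a\<close> is maximal and
    tied with the maximizing \<open>v\<close>.\<close>
  define slope where "slope v = (weight u v - B) / (real (lookup a j) - real (lookup v j))" for v
  obtain v where v: "v \<in> K - {a}" "\<And>v'. v' \<in> K - {a} \<Longrightarrow> slope v' \<le> slope v"
    using ex_maximal_value[of "K - {a}" slope] finite_K b(1) \<open>b \<noteq> a\<close> by blast
  have "slope b > 0"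
    using ub a(3)[OF b(1) \<open>b \<noteq> a\<close>] by (simp add: slope_def)
  also have "slope b \<le> slope v"
    using v(2) b(1) \<open>b \<noteq> a\<close> by simp
  finally have pos: "slope v > 0" .
  have zero: "weight u z \<le> B" if "z \<in> K" "lookup z j = 0" for z
    using bound[OF that] that by (simp add: u)
  have vj: "lookup v j \<noteq> 0"
  proof
    assume "lookup v j = 0"
    hence "slope v \<le> 0"
      using zero[of v] v(1) a(2) by (simp add: slope_def divide_le_0_iff)
    with pos show False by simp
  qed
  define x where "x = u + axis j (slope v)"
  have x: "weight x c = weight u c + slope v * real (lookup c j)" for c
    by (simp add: x_def weight_add_left)
  have "weight x c \<le> weight x a" if c: "c \<in> K" for c
  proof (cases "c = a")
    case False
    have "slope c \<le> slope v" using v(2) c False by simp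
    hence "weight u c - B \<le> slope v * (real (lookup a j) - real (lookup c j))"
      using a(3)[OF c False] by (simp add: slope_def pos_divide_le_eq)
    thus ?thesis by (simp add: x ua algebra_simps)
  qed simp
  moreover have "slope v * (real (lookup a j) - real (lookup v j)) = weight u v - B"
    using a(3)[of v] v(1) by (simp add: slope_def)
  hence "weight x v = weight x a"
    by (simp add: x ua algebra_simps)
  ultimately have face: "a \<in> face x K" "v \<in> face x K"
    using a(1) v(1) by (auto simp: face_def)
  obtain z where z: "z \<in> K" "lookup z j = 0"
    using ex_lookup_eq_0 by blast
  \<comment> \<open>Since the final tilt is positive, \<open>a\<close> now lies strictly above
    \<open>B\<close>. So \<open>z\<close> is off the face, the face is proper, and \<open>a\<close>
    and \<open>v\<close> must be disjoint although both involve \<open>j\<close>.\<close>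
  have "weight x z \<le> B"
    using zero[OF z] z(2) by (simp add: x)
  also have "B < weight x a"
    using pos a(2) by (simp add: x ua)
  finally have "z \<notin> face x K"
    using a(1) by (auto simp: face_def not_le intro: bexI[of _ a])
  hence "coprime_disjoint (face x K)"
    using z(1) by (intro proper_faces) auto
  hence "keys a \<inter> keys v = {}"
    using face v(1) by (auto simp: coprime_disjoint_def)
  thus False using a(2) vj by (auto simp: in_keys_iff)
qed

text \<open>The interpolation bound with \<open>B = weight w b\<close>, divided by
  \<open>\<mu> > 0\<close>. It moves the maximum of a weight over \<open>K\<close> from
  \<open>b\<close> to \<open>top j\<close>.\<close>

lemma le_of_interpolation:
  assumes b: "b \<in> K" "lookup b j \<noteq> 0"
    and le: "\<And>v. v \<in> K \<Longrightarrow> weight w v \<le> weight w b"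
  shows "weight w b \<le> weight w (top j)"
proof -
  define \<mu> where "\<mu> = real (lookup b j) / real (lookup (top j) j)"
  have "\<mu> > 0"
    using b lookup_top[OF b] by (simp add: \<mu>_def)
  moreover have "weight w b \<le> \<mu> * weight w (top j) + (1 - \<mu>) * weight w b"
    unfolding \<mu>_def by (intro weight_le_interpolation b le)
  hence "\<mu> * weight w b \<le> \<mu> * weight w (top j)"
    by (simp add: algebra_simps)
  ultimately show ?thesis by simp
qed

text \<open>Restricted to variables that occur in \<open>K\<close>, because \<open>top j\<close> is
  an arbitrary choice for the others.\<close>

definition tops :: "'n expvec set" where
  "tops = top ` {j. \<exists>b\<in>K. lookup b j \<noteq> 0}"

lemma tops_subset: "tops \<subseteq> K"
  using top(1) by (auto simp: tops_def)

lemma finite_tops: "finite tops"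
  by (simp add: tops_def)

lemma top_in_tops: "b \<in> K \<Longrightarrow> lookup b j \<noteq> 0 \<Longrightarrow> top j \<in> tops"
  by (auto simp: tops_def)

lemma tops_nonzero:
  assumes "a \<in> tops"
  shows "a \<noteq> 0"
proof -
  obtain j b where j: "b \<in> K" "lookup b j \<noteq> 0" and a: "a = top j"
    using assms by (auto simp: tops_def)
  have "lookup a j \<noteq> 0"
    using lookup_top(1)[OF j] by (simp add: a)
  thus ?thesis by auto
qed

text \<open>Write \<open>a = top j\<close>. As \<open>a\<close> maximizes the \<open>j\<close>-th
  coordinate and involves \<open>k\<close>, the exponent \<open>top k\<close> attains that maximum
  as well, and the maximizer is unique.\<close>

lemma top_unique:
  assumes "a \<in> tops" "lookup a k \<noteq> 0"
  shows "top k = a"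
proof (rule ccontr)
  assume ne: "top k \<noteq> a"
  obtain j b0 where j: "b0 \<in> K" "lookup b0 j \<noteq> 0" "a = top j"
    using assms(1) by (auto simp: tops_def)
  have a: "a \<in> K" using assms(1) tops_subset by blast
  have "weight (axis j 1) v \<le> weight (axis j 1) a" if "v \<in> K" for v
    using top(2)[OF j(1,2) that] by (cases "v = a") (auto simp: j(3))
  hence "weight (axis j 1) a \<le> weight (axis j 1) (top k)"
    by (rule le_of_interpolation[OF a assms(2)])
  moreover have "lookup (top k) j < lookup a j"
    using top(2)[OF j(1,2) top(1)[OF a assms(2)]] ne by (simp add: j(3))
  ultimately show False by simp
qed

lemma tops_disjoint:
  assumes "a \<in> tops" "b \<in> tops" "a \<noteq> b"
  shows "keys a \<inter> keys b = {}"
proof (rule ccontr)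
  assume "keys a \<inter> keys b \<noteq> {}"
  then obtain k where "k \<in> keys a" "k \<in> keys b" by blast
  hence "top k = a" "top k = b"
    using assms by (auto simp: in_keys_iff intro!: top_unique)
  with assms(3) show False by simp
qed

text \<open>Interpolation for the negated \<open>k\<close>-th coordinate, with bound
  \<open>0\<close>, gives one inequality; exchanging \<open>i\<close> and \<open>k\<close> gives the
  other.\<close>

lemma lookup_proportional:
  assumes a: "a \<in> tops" "lookup a i \<noteq> 0" "lookup a k \<noteq> 0" and b: "b \<in> K"
  shows "real (lookup b i) / real (lookup a i) = real (lookup b k) / real (lookup a k)"
proof -
  have le: "real (lookup b i) / real (lookup a i) \<le> real (lookup b k) / real (lookup a k)"
    if "lookup a i \<noteq> 0" "lookup a k \<noteq> 0" for i k
  proof (cases "lookup b i = 0")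
    case False
    have "weight (axis k (- 1)) b \<le> real (lookup b i) / real (lookup (top i) i) * weight (axis k (- 1)) (top i)
        + (1 - real (lookup b i) / real (lookup (top i) i)) * 0"
      by (rule weight_le_interpolation[OF b False]) simp
    hence "real (lookup b i) / real (lookup a i) * real (lookup a k) \<le> real (lookup b k)"
      by (simp add: top_unique[OF a(1) that(1)])
    thus ?thesis using that by (simp add: pos_le_divide_eq)
  qed simp
  show ?thesis
    by (intro antisym le a)
qed

lemma ratio_mult_lookup:
  assumes "a \<in> tops" "b \<in> K"
  shows "ratio a b * real (lookup a k) = (if lookup a k = 0 then 0 else real (lookup b k))"
proof (cases "lookup a k = 0")
  case False
  thus ?thesis
    using lookup_proportional[OF assms(1) lookup_index[OF tops_nonzero[OF assms(1)]] False assms(2)]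
    by (simp add: ratio_def)
qed auto

text \<open>If \<open>k\<close> occurs in \<open>b\<close>, exactly one element of
  \<open>tops\<close> involves \<open>k\<close>, so only one summand survives.\<close>

lemma lookup_eq_sum:
  assumes b: "b \<in> K"
  shows "real (lookup b k) = (\<Sum>a\<in>tops. ratio a b * real (lookup a k))"
proof (cases "lookup b k = 0")
  case True
  thus ?thesis
    using b by (simp add: ratio_mult_lookup cong: if_cong)
next
  case False
  have "(\<Sum>a\<in>tops. ratio a b * real (lookup a k)) = (\<Sum>a\<in>tops. if a = top k then real (lookup b k) else 0)"
  proof (intro sum.cong refl)
    fix a assume a: "a \<in> tops"
    have "lookup a k \<noteq> 0 \<longleftrightarrow> a = top k"
      using top_unique[OF a] lookup_top(1)[OF b False] by auto
    thus "ratio a b * real (lookup a k) = (if a = top k then real (lookup b k) else 0)"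
      using ratio_mult_lookup[OF a b, of k] by auto
  qed
  also have "\<dots> = real (lookup b k)"
    using top_in_tops[OF b False] finite_tops by simp
  finally show ?thesis by simp
qed

text \<open>The ratios are nonnegative, so equal sums force those outside \<open>A\<close> to
  vanish. This is used to place exponents on an edge.\<close>

lemma lookup_eq_partial_sum:
  assumes b: "b \<in> K" and A: "A \<subseteq> tops" and eq: "(\<Sum>a\<in>A. ratio a b) = (\<Sum>a\<in>tops. ratio a b)"
  shows "real (lookup b k) = (\<Sum>a\<in>A. ratio a b * real (lookup a k))"
proof -
  have "(\<Sum>a\<in>tops - A. ratio a b) = 0"
    using eq finite_tops A by (simp add: sum_diff finite_subset)
  hence "\<forall>a\<in>tops - A. ratio a b = 0"
    using finite_tops ratio_nonneg by (subst (asm) sum_nonneg_eq_0_iff) auto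
  hence "(\<Sum>a\<in>tops. ratio a b * real (lookup a k)) = (\<Sum>a\<in>A. ratio a b * real (lookup a k))"
    using finite_tops A by (intro sum.mono_neutral_right) auto
  thus ?thesis
    using lookup_eq_sum[OF b, of k] by simp
qed

lemma ratio_tops:
  assumes "a \<in> tops" "b \<in> tops"
  shows "ratio a b = (if a = b then 1 else 0)"
proof (cases "a = b")
  case True
  thus ?thesis using ratio_self[OF tops_nonzero] assms by simp
next
  case False
  hence "lookup b (index a) = 0"
    using tops_disjoint[OF assms] lookup_index[OF tops_nonzero[OF assms(1)]]
    by (auto simp: in_keys_iff)
  thus ?thesis using False by (simp add: ratio_def)
qed

lemma ratio_zero [simp]: "ratio a 0 = 0"
  by (simp add: ratio_def)

section \<open>Convex combinations and coprimality of the top exponents\<close>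

definition total :: "real ^ 'n" where
  "total = (\<Sum>a\<in>tops. ratio_weight a)"

lemma weight_total: "weight total b = (\<Sum>a\<in>tops. ratio a b)"
  by (simp add: total_def weight_sum_left)

lemma weight_total_tops:
  assumes "a \<in> tops"
  shows "weight total a = 1"
proof -
  have "weight total a = (\<Sum>c\<in>tops. if c = a then 1 else 0)"
    unfolding weight_total using assms by (intro sum.cong) (auto simp: ratio_tops)
  thus ?thesis using assms finite_tops by simp
qed

text \<open>The maximum of \<open>total\<close> over \<open>K\<close> is attained at
  \<open>0\<close> or is bounded by the value at some element of \<open>tops\<close>, which is
  \<open>1\<close>.\<close>

lemma weight_total_le:
  assumes "b \<in> K"
  shows "weight total b \<le> 1"
proof -
  obtain c where c: "c \<in> K" "\<And>v. v \<in> K \<Longrightarrow> weight total v \<le> weight total c"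
    using ex_maximal_value[OF finite_K, of "weight total"] assms by blast
  have "weight total c \<le> 1"
  proof (cases "c = 0")
    case False
    note j = lookup_index[OF this]
    show ?thesis
      using le_of_interpolation[OF c(1) j c(2)] weight_total_tops[OF top_in_tops[OF c(1) j]] by simp
  qed simp
  with c(2)[OF assms] show ?thesis by simp
qed

text \<open>The same argument for \<open>- total\<close> bounds the minimum from below, because the
  minimizer is now nonzero.\<close>

lemma weight_total_eq_1:
  assumes "b \<in> K" "0 \<notin> K"
  shows "weight total b = 1"
proof -
  obtain c where c: "c \<in> K" "\<And>v. v \<in> K \<Longrightarrow> weight (- total) v \<le> weight (- total) c"
    using ex_maximal_value[OF finite_K, of "weight (- total)"] assms by blast
  have "c \<noteq> 0" using c(1) assms(2) by auto
  note j = lookup_index[OF this]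
  have "weight total c \<ge> 1"
    using le_of_interpolation[OF c(1) j c(2)] weight_total_tops[OF top_in_tops[OF c(1) j]] by simp
  with c(2)[OF assms(1)] weight_total_le[OF assms(1)] show ?thesis by simp
qed

lemma ratio_le_1:
  assumes "a \<in> tops" "b \<in> K"
  shows "ratio a b \<le> 1"
proof -
  have "ratio a b \<le> (\<Sum>c\<in>tops. ratio c b)"
    using assms(1) finite_tops ratio_nonneg by (intro member_le_sum) auto
  thus ?thesis using weight_total_le[OF assms(2)] by (simp add: weight_total)
qed

text \<open>The sum of the functionals \<open>ratio a\<close> and \<open>ratio b\<close> is at most
  \<open>total\<close>, hence at most \<open>1\<close> on \<open>K\<close>. Equality kills all other
  ratios, so the face lies on the segment from \<open>a\<close> to \<open>b\<close>.\<close>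

lemma gcd_tops:
  assumes ab: "a \<in> tops" "b \<in> tops" "a \<noteq> b"
  shows "gcd_expvec a b = 1"
proof -
  define w where "w = ratio_weight a + ratio_weight b"
  have w: "weight w v = ratio a v + ratio b v" for v
    by (simp add: w_def weight_add_left)
  have two: "(\<Sum>c\<in>{a, b}. ratio c v) = ratio a v + ratio b v" for v
    using ab(3) by simp
  have le: "ratio a v + ratio b v \<le> weight total v" for v
    unfolding weight_total two[symmetric]
    using ab finite_tops ratio_nonneg by (intro sum_mono2) auto
  have wab: "weight w a = 1" "weight w b = 1"
    using ab by (auto simp: w ratio_tops)
  have "weight w v \<le> 1" if "v \<in> K" for v
    using le[of v] weight_total_le[OF that] by (simp add: w)
  with wab have face: "a \<in> face w K" "b \<in> face w K"
    using ab tops_subset by (auto simp: face_def)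
  show ?thesis
  proof (rule gcd_edge[OF face ab(3) tops_disjoint[OF ab]])
    fix v assume v: "v \<in> face w K"
    hence vK: "v \<in> K" using face_subset by blast
    have "weight w v \<ge> 1" using v face(1) wab(1) by (auto simp: face_def)
    hence eq: "ratio a v + ratio b v = 1" "weight total v = 1"
      using le[of v] weight_total_le[OF vK] by (auto simp: w)
    have "exponent_vector v = (1 - ratio b v) *\<^sub>R exponent_vector a + ratio b v *\<^sub>R exponent_vector b"
    proof (rule vec_eq_iff[THEN iffD2], rule allI)
      fix k
      have "real (lookup v k) = (\<Sum>c\<in>{a, b}. ratio c v * real (lookup c k))"
        using ab eq two[of v] by (intro lookup_eq_partial_sum[OF vK]) (auto simp: weight_total)
      thus "exponent_vector v $ k =
          ((1 - ratio b v) *\<^sub>R exponent_vector a + ratio b v *\<^sub>R exponent_vector b) $ k"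
        using ab(3) eq(1) by (simp flip: eq(1))
    qed
    thus "\<exists>t\<in>{0..1}. exponent_vector v = (1 - t) *\<^sub>R exponent_vector a + t *\<^sub>R exponent_vector b"
      using ratio_nonneg ratio_le_1[OF ab(2) vK] by (intro bexI[of _ "ratio b v"]) auto
  qed
qed

text \<open>The weight \<open>ratio a\<close> minus \<open>total\<close> is nonpositive and vanishes
  at \<open>0\<close> and \<open>a\<close>. Where it vanishes on \<open>K\<close> only
  \<open>ratio a\<close> survives, so the face lies on the segment from \<open>0\<close> to
  \<open>a\<close>.\<close>

lemma gcd_zero_tops:
  assumes a: "a \<in> tops" and zero: "0 \<in> K"
  shows "gcd_expvec 0 a = 1"
proof -
  define w where "w = ratio_weight a - total"
  have w: "weight w v = ratio a v - weight total v" for v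
    by (simp add: w_def weight_diff_left)
  have le: "ratio a v \<le> weight total v" for v
    unfolding weight_total using a finite_tops ratio_nonneg by (intro member_le_sum) auto
  have wa: "weight w a = 0"
    using a by (simp add: w weight_total_tops ratio_tops)
  have face: "0 \<in> face w K" "a \<in> face w K"
    using a zero tops_subset wa le by (auto simp: face_def w weight_total)
  show ?thesis
  proof (rule gcd_edge[OF face])
    fix v assume v: "v \<in> face w K"
    hence vK: "v \<in> K" using face_subset by blast
    have "weight w v \<ge> 0" using v face(1) by (auto simp: face_def)
    hence eq: "ratio a v = weight total v"
      using le[of v] by (auto simp: w)
    have "exponent_vector v = (1 - ratio a v) *\<^sub>R exponent_vector 0 + ratio a v *\<^sub>R exponent_vector a"
    proof (rule vec_eq_iff[THEN iffD2], rule allI)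
      fix k
      have "real (lookup v k) = (\<Sum>c\<in>{a}. ratio c v * real (lookup c k))"
        using a eq by (intro lookup_eq_partial_sum[OF vK]) (auto simp: weight_total)
      thus "exponent_vector v $ k =
          ((1 - ratio a v) *\<^sub>R exponent_vector 0 + ratio a v *\<^sub>R exponent_vector a) $ k"
        by simp
    qed
    thus "\<exists>t\<in>{0..1}. exponent_vector v = (1 - t) *\<^sub>R exponent_vector 0 + t *\<^sub>R exponent_vector a"
      using ratio_nonneg ratio_le_1[OF a vK] by (intro bexI[of _ "ratio a v"]) auto
  qed (use a tops_nonzero in auto)
qed

definition vertices :: "'n expvec set" where
  "vertices = tops \<union> (K \<inter> {0})"

lemma coprime_disjoint_vertices: "coprime_disjoint vertices"
  unfolding coprime_disjoint_def vertices_def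
  using tops_disjoint gcd_tops gcd_zero_tops by (auto simp: gcd_expvec_commute[of _ 0])

lemma ratio_Ints:
  assumes a: "a \<in> tops" and b: "b \<in> K"
  shows "ratio a b \<in> \<int>"
proof -
  \<comment> \<open>The coefficients of \<open>b\<close> as a convex combination of
    \<open>vertices\<close>: the exponent \<open>0\<close> receives what the others leave of
    \<open>1\<close>.\<close>
  define t where "t c = (if c = 0 then 1 - weight total b else ratio c b)" for c
  have sum: "(\<Sum>c\<in>tops. t c) = weight total b"
    using tops_nonzero by (auto simp: weight_total t_def intro!: sum.cong)
  have "t a \<in> \<int>"
  proof (rule coprime_combination_Ints[of vertices])
    show "finite vertices" using finite_tops by (simp add: vertices_def)
    show "a \<in> vertices" using a by (simp add: vertices_def)
    show "gcd_expvec c d = 1" if "c \<in> vertices" "d \<in> vertices" "c \<noteq> d" for c d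
      using that coprime_disjoint_vertices by (simp add: coprime_disjoint_def)
    show "t c * real (lookup c j) \<in> \<int>" if "c \<in> vertices" for c j
      using that tops_nonzero ratio_mult_lookup[OF _ b, of c j] by (auto simp: vertices_def t_def)
    have "(\<Sum>c\<in>vertices. t c) = 1"
    proof (cases "0 \<in> K")
      case True
      hence "vertices = insert 0 tops" by (auto simp: vertices_def)
      moreover have "0 \<notin> tops" using tops_nonzero by blast
      ultimately show ?thesis
        using sum finite_tops by (simp add: t_def)
    next
      case False
      hence "vertices = tops" by (auto simp: vertices_def)
      thus ?thesis using sum weight_total_eq_1[OF b False] by simp
    qed
    thus "(\<Sum>c\<in>vertices. t c) \<in> \<int>" by simp
  qed
  thus ?thesis using tops_nonzero[OF a] by (simp add: t_def)
qed

text \<open>The ratios of \<open>b\<close> are nonnegative integers with sum at most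
  \<open>1\<close>: either all vanish and \<open>b = 0\<close>, or a single one equals
  \<open>1\<close> and \<open>b\<close> is that element of \<open>tops\<close>.\<close>

lemma K_subset_vertices: "K \<subseteq> vertices"
proof
  fix b assume b: "b \<in> K"
  show "b \<in> vertices"
  proof (cases "\<forall>a\<in>tops. ratio a b = 0")
    case True
    have "b = 0"
    proof (rule poly_mapping_eqI)
      fix k show "lookup b k = lookup 0 k"
        using lookup_eq_sum[OF b, of k] True by simp
    qed
    thus ?thesis using b by (simp add: vertices_def)
  next
    case False
    then obtain a where a: "a \<in> tops" "ratio a b \<noteq> 0" by blast
    obtain m where m: "ratio a b = of_int m"
      using ratio_Ints[OF a(1) b] by (auto elim: Ints_cases)
    have "m = 1"
      using m a(2) ratio_nonneg[of a b] ratio_le_1[OF a(1) b] by simp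
    hence eq: "ratio a b = 1" using m by simp
    have "ratio a b \<le> (\<Sum>c\<in>tops. ratio c b)"
      using a finite_tops ratio_nonneg by (intro member_le_sum) auto
    hence "(\<Sum>c\<in>{a}. ratio c b) = (\<Sum>c\<in>tops. ratio c b)"
      using eq weight_total_le[OF b] by (simp add: weight_total)
    from lookup_eq_partial_sum[OF b _ this] a have "lookup b k = lookup a k" for k
      by (simp add: eq)
    hence "b = a" by (rule poly_mapping_eqI)
    thus ?thesis using a by (simp add: vertices_def)
  qed
qed

lemma coprime_disjoint_K: "coprime_disjoint K"
  using coprime_disjoint_vertices K_subset_vertices
  unfolding coprime_disjoint_def by blast

end

text \<open>Proper faces are smaller and inherit the condition, which permits induction on the
  cardinality; fewer than two exponents leave no pair to check.\<close>

lemma coprime_disjoint_if_well_poised_faces: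
  assumes "finite K" "well_poised_faces K"
  shows "coprime_disjoint K"
  using assms
proof (induction "card K" arbitrary: K rule: less_induct)
  case less
  show ?case
  proof (cases "card K \<ge> 2")
    case True
    interpret well_poised_set K
    proof
      fix w assume "face w K \<noteq> K"
      hence "face w K \<subset> K" using face_subset[of w K] by blast
      hence "card (face w K) < card K" "finite (face w K)"
        using less.prems(1) by (auto intro: psubset_card_mono finite_subset)
      thus "coprime_disjoint (face w K)"
        using less well_poised_faces_face by blast
    qed (use less.prems True in auto)
    show ?thesis by (rule coprime_disjoint_K)
  next
    case False
    hence "card K \<le> Suc 0" by simp
    thus ?thesis
      using less.prems(1) by (auto simp: coprime_disjoint_def card_le_Suc0_iff_eq)
  qed
qed

subsection \<open>Initial forms\<close>

lemma lookup_initial_form: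
  "lookup (initial_form w f) a = (if a \<in> face w (keys f) then lookup f a else 0)"
proof -
  have "finite (face w (keys f))"
    using face_subset finite_keys by (rule finite_subset)
  moreover have "lookup (initial_form w f) a = (\<Sum>b\<in>face w (keys f). if b = a then lookup f b else 0)"
    unfolding initial_form_def face_def[symmetric]
    by (simp add: lookup_sum lookup_single when_def)
  ultimately show ?thesis by simp
qed

lemma keys_initial_form: "keys (initial_form w f) = face w (keys f)"
  using face_subset[of w "keys f"] by (auto simp: in_keys_iff lookup_initial_form split: if_splits)

lemma sum_single_superset:
  assumes "finite A" "keys f \<subseteq> A"
  shows "(\<Sum>a\<in>A. Poly_Mapping.single a (lookup f a)) = f"
proof (rule poly_mapping_eqI)
  fix k
  have "lookup (\<Sum>a\<in>A. Poly_Mapping.single a (lookup f a)) k = (\<Sum>a\<in>A. if a = k then lookup f a else 0)"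
    by (simp add: lookup_sum lookup_single when_def)
  thus "lookup (\<Sum>a\<in>A. Poly_Mapping.single a (lookup f a)) k = lookup f k"
    using assms by (auto simp: in_keys_iff)
qed

text \<open>Otherwise the variable \<open>j\<close> splits off; irreducibility makes the cofactor
  constant and leaves \<open>f\<close> with one term.\<close>

lemma irreducible_avoids_variable:
  fixes f :: "('n::finite, 'k::field) mpoly"
  assumes irred: "irreducible f" and two: "card (keys f) \<ge> 2"
  shows "\<exists>a\<in>keys f. lookup a j = 0"
proof (rule ccontr)
  assume "\<not> (\<exists>a\<in>keys f. lookup a j = 0)"
  hence pos: "\<And>a. a \<in> keys f \<Longrightarrow> lookup a j \<noteq> 0" by metis
  define e :: "'n expvec" where "e = Poly_Mapping.single j 1"
  define x :: "('n, 'k) mpoly" where "x = Poly_Mapping.single e 1"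
  define g where "g = (\<Sum>a\<in>keys f. Poly_Mapping.single (a - e) (lookup f a))"
  have "e + (a - e) = a" if "a \<in> keys f" for a
    using pos[OF that]
    by (intro poly_mapping_eqI) (auto simp: e_def lookup_add lookup_minus lookup_single when_def)
  hence "x * g = (\<Sum>a\<in>keys f. Poly_Mapping.single a (lookup f a))"
    unfolding g_def x_def sum_distrib_left by (intro sum.cong) (simp_all add: mult_single)
  hence f: "f = x * g"
    by (simp add: sum_single_superset)
  have "lookup e j = 1"
    by (simp add: e_def)
  hence "e \<noteq> 0" by auto
  hence "\<not> x dvd 1"
    by (simp add: mpoly_dvd_one_iff x_def)
  hence "g dvd 1"
    using irreducibleD[OF irred f] by blast
  hence "keys g \<subseteq> {0}"
    by (simp add: mpoly_dvd_one_iff)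
  hence "keys f \<subseteq> {e}"
    unfolding f using keys_mult[of x g] by (fastforce simp: x_def)
  hence "card (keys f) \<le> 1"
    using card_mono[of "{e}" "keys f"] by simp
  with two show False by simp
qed

definition scale :: "nat \<Rightarrow> 'n::finite expvec \<Rightarrow> 'n expvec" where
  "scale m a = Abs_poly_mapping (\<lambda>k. m * lookup a k)"

lemma lookup_scale [simp]: "lookup (scale m a) k = m * lookup a k"
  by (simp add: scale_def)

lemma single_power: "Poly_Mapping.single a c ^ m = Poly_Mapping.single (scale m a) (c ^ m)"
  for c :: "'k::comm_semiring_1"
proof (induction m)
  case 0
  have "scale 0 a = 0" by (rule poly_mapping_eqI) simp
  thus ?case by simp
next
  case (Suc m)
  have "a + scale m a = scale (Suc m) a"
    by (rule poly_mapping_eqI) (simp add: lookup_add)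
  thus ?case using Suc by (simp add: mult_single)
qed

lemma single_sum: "Poly_Mapping.single a (\<Sum>i\<in>A. c i) = (\<Sum>i\<in>A. Poly_Mapping.single a (c i))"
  by (induction A rule: infinite_finite_induct) (simp_all add: single_add)

lemma ex_scale_eq:
  assumes "\<And>k. m dvd lookup a k"
  shows "\<exists>b. a = scale m b"
proof -
  have "a = scale m (Abs_poly_mapping (\<lambda>k. lookup a k div m))"
    using assms by (intro poly_mapping_eqI) simp
  thus ?thesis ..
qed

text \<open>
  If \<open>m\<close> is the gcd of the endpoints of a segment, then \<open>f\<close> is a binary form of degree \<open>m\<close> in two
  monomials, and a root of its dehomogenization provides a linear factor.
\<close>

lemma irreducible_segment_gcd:
  fixes f :: "('n::finite, 'k::alg_closed_field) mpoly"
  assumes irred: "irreducible f" and p: "p \<in> keys f" and q: "q \<in> keys f" and "p \<noteq> q"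
    and disjoint: "keys p \<inter> keys q = {}"
    and segment: "\<And>b. b \<in> keys f \<Longrightarrow>
      \<exists>t\<in>{0..1}. exponent_vector b = (1 - t) *\<^sub>R exponent_vector p + t *\<^sub>R exponent_vector q"
  shows "gcd_expvec p q = 1"
proof (rule ccontr)
  define m where "m = gcd_expvec p q"
  have dvd: "m dvd lookup p k" "m dvd lookup q k" for k
    unfolding m_def gcd_expvec_def by (auto intro: Gcd_dvd)
  have zero: "lookup p k = 0 \<or> lookup q k = 0" for k
    using disjoint by (auto simp: in_keys_iff)
  have "m \<noteq> 0"
  proof
    assume "m = 0"
    hence "p = q" using dvd by (intro poly_mapping_eqI) simp
    with \<open>p \<noteq> q\<close> show False by simp
  qed
  moreover assume "gcd_expvec p q \<noteq> 1"
  ultimately have m: "m \<ge> 2" by (simp add: m_def)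
  obtain P Q where PQ: "p = scale m P" "q = scale m Q"
    using ex_scale_eq[of m p] ex_scale_eq[of m q] dvd by blast
  have zero': "lookup P k = 0 \<or> lookup Q k = 0" for k
    using zero[of k] m by (simp add: PQ)
  have "P \<noteq> Q" using \<open>p \<noteq> q\<close> PQ by auto
  \<comment> \<open>Exponents of the degree \<open>m\<close> monomials in the two monomials with
    exponents \<open>P\<close> and \<open>Q\<close>, running from \<open>p\<close> at
    \<open>i = 0\<close> to \<open>q\<close> at \<open>i = m\<close>.\<close>
  define E where "E i = scale (m - i) P + scale i Q" for i
  have E0: "E 0 = p" and Em: "E m = q"
    by (auto intro!: poly_mapping_eqI simp: E_def PQ lookup_add)
  have inj: "inj_on E {..m}"
  proof (rule inj_onI)
    fix i i' assume i: "i \<in> {..m}" "i' \<in> {..m}" "E i = E i'"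
    obtain k where k: "lookup P k \<noteq> lookup Q k"
      using \<open>P \<noteq> Q\<close> poly_mapping_eqI by metis
    have "(m - i) * lookup P k + i * lookup Q k = (m - i') * lookup P k + i' * lookup Q k"
      using arg_cong[OF i(3), of "\<lambda>a. lookup a k"] by (simp add: E_def lookup_add)
    thus "i = i'" using k zero'[of k] i(1,2) by auto
  qed
  have keys: "keys f \<subseteq> E ` {..m}"
  proof
    fix b assume b: "b \<in> keys f"
    obtain t where t: "0 \<le> t" "t \<le> 1"
      and bt: "exponent_vector b = (1 - t) *\<^sub>R exponent_vector p + t *\<^sub>R exponent_vector q"
      using segment[OF b] by auto
    have bk: "real (lookup b k) = (1 - t) * real (lookup p k) + t * real (lookup q k)" for k
      using arg_cong[OF bt, of "\<lambda>v. v $ k"] by simp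
    \<comment> \<open>Where one of \<open>p\<close> and \<open>q\<close> has a nonzero entry the
      other vanishes, so \<open>t\<close> times that entry is a difference of natural numbers;
      \<open>m\<close> is the gcd of all entries.\<close>
    have "t * real m \<in> \<int>"
      unfolding m_def gcd_expvec_def
    proof (rule Ints_mult_Gcd)
      fix x assume x: "x \<in> range (lookup p) \<union> range (lookup q)"
      then obtain k where k: "x = lookup p k \<or> x = lookup q k" by blast
      have "t * real (lookup p k) = (if lookup p k = 0 then 0 else real (lookup p k) - real (lookup b k))"
        "t * real (lookup q k) = (if lookup q k = 0 then 0 else real (lookup b k))"
        using bk[of k] zero[of k] by (auto simp: algebra_simps)
      with k show "t * real x \<in> \<int>" by auto
    qed simp
    then obtain z where z: "t * real m = of_int z" by (auto elim: Ints_cases)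
    have "0 \<le> real_of_int z" "real_of_int z \<le> real m"
      using t by (simp_all flip: z add: mult_left_le_one_le)
    hence z_bounds: "0 \<le> z" "z \<le> int m" by linarith+
    define i where "i = nat z"
    have i: "i \<le> m" "real i = t * real m"
      using z z_bounds by (auto simp: i_def)
    have "b = E i"
    proof (rule poly_mapping_eqI)
      fix k
      have "real (lookup b k) = (real m - real i) * real (lookup P k) + real i * real (lookup Q k)"
        using bk[of k] by (simp add: PQ i(2) algebra_simps)
      also have "\<dots> = real (lookup (E i) k)"
        using i(1) by (simp add: E_def lookup_add of_nat_diff)
      finally show "lookup b k = lookup (E i) k" by simp
    qed
    thus "b \<in> E ` {..m}" using i(1) by blast
  qed
  define c where "c i = lookup f (E i)" for i
  have f: "f = (\<Sum>i\<le>m. Poly_Mapping.single (E i) (c i))"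
  proof -
    have "f = (\<Sum>b\<in>E ` {..m}. Poly_Mapping.single b (lookup f b))"
      using keys by (intro sum_single_superset[symmetric]) auto
    thus ?thesis
      using inj by (simp add: sum.reindex c_def)
  qed
  have "c m \<noteq> 0" "c 0 \<noteq> 0"
    using p q by (auto simp: c_def E0 Em in_keys_iff)
  obtain r where r: "(\<Sum>i\<le>m. c i * r ^ i) = 0"
    using alg_closed[of m c] \<open>c m \<noteq> 0\<close> m by auto
  \<comment> \<open>Needed for \<open>Y - X\<close> to have two terms and hence not to be a
    unit.\<close>
  have "r \<noteq> 0"
  proof
    assume "r = 0"
    hence "(\<Sum>i\<le>m. c i * r ^ i) = (\<Sum>i\<in>{0}. c i * r ^ i)"
      by (intro sum.mono_neutral_right) auto
    with r \<open>c 0 \<noteq> 0\<close> show False by simp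
  qed
  \<comment> \<open>The linear factor for the root \<open>r\<close> is \<open>Y - X\<close>: the sum
    of all \<open>S i * Y ^ i\<close> is \<open>f\<close>, and with \<open>X\<close> in place of
    \<open>Y\<close> it is \<open>0\<close>.\<close>
  define X :: "('n, 'k) mpoly" where "X = Poly_Mapping.single P r"
  define Y :: "('n, 'k) mpoly" where "Y = Poly_Mapping.single Q 1"
  define S where "S i = Poly_Mapping.single (scale (m - i) P) (c i)" for i
  have SY: "S i * Y ^ i = Poly_Mapping.single (E i) (c i)" for i
    by (simp add: S_def Y_def single_power mult_single E_def)
  have SX: "S i * X ^ i = Poly_Mapping.single p (c i * r ^ i)" if "i \<le> m" for i
  proof -
    have "scale (m - i) P + scale i P = p"
      using that by (intro poly_mapping_eqI) (simp add: PQ lookup_add flip: add_mult_distrib)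
    thus ?thesis by (simp add: S_def X_def single_power mult_single)
  qed
  have "(\<Sum>i\<le>m. S i * X ^ i) = Poly_Mapping.single p (\<Sum>i\<le>m. c i * r ^ i)"
    unfolding single_sum by (intro sum.cong) (auto simp: SX)
  hence "(\<Sum>i\<le>m. S i * X ^ i) = 0"
    by (simp add: r)
  hence "f = (\<Sum>i\<le>m. S i * (Y ^ i - X ^ i))"
    by (simp add: f SY right_diff_distrib sum_subtractf)
  moreover have "Y - X dvd S i * (Y ^ i - X ^ i)" for i
    by (simp add: power_diff_sumr2)
  ultimately have "Y - X dvd f"
    by (auto intro: dvd_sum)
  then obtain D where D: "f = (Y - X) * D" ..
  have lookup_YX: "lookup (Y - X) Q = 1" "lookup (Y - X) P = - r"
    using \<open>P \<noteq> Q\<close> by (auto simp: X_def Y_def lookup_minus lookup_single when_def)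
  have "\<not> Y - X dvd 1"
  proof
    assume "Y - X dvd 1"
    hence "keys (Y - X) \<subseteq> {0}" by (simp add: mpoly_dvd_one_iff)
    moreover have "P \<in> keys (Y - X)" "Q \<in> keys (Y - X)"
      using lookup_YX \<open>r \<noteq> 0\<close> by (auto simp: in_keys_iff)
    ultimately show False using \<open>P \<noteq> Q\<close> by blast
  qed
  hence "D dvd 1"
    using irreducibleD[OF irred D] by blast
  hence "keys D \<subseteq> {0}" by (simp add: mpoly_dvd_one_iff)
  \<comment> \<open>A constant cofactor forces \<open>p\<close> and \<open>q\<close> into
    \<open>{P, Q}\<close>. As they are \<open>m\<close>-fold multiples with \<open>m \<ge> 2\<close>
    and disjoint supports, \<open>P\<close> and \<open>Q\<close> would both vanish.\<close>
  hence "keys f \<subseteq> keys (Y - X)"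
    unfolding D using keys_mult[of "Y - X" D] by fastforce
  also have "\<dots> \<subseteq> {P, Q}"
    by (auto simp: X_def Y_def in_keys_iff lookup_minus lookup_single when_def split: if_splits)
  finally have pq: "p \<in> {P, Q}" "q \<in> {P, Q}" using p q by blast+
  have "lookup P k = lookup Q k" for k
  proof -
    have "lookup p k = m * lookup P k" "lookup q k = m * lookup Q k"
      by (simp_all add: PQ)
    thus ?thesis using pq zero'[of k] m by auto
  qed
  with \<open>P \<noteq> Q\<close> show False using poly_mapping_eqI by blast
qed

lemma well_poised_faces_keys:
  fixes f :: "('n::finite, 'k::alg_closed_field) mpoly"
  assumes "well_poised f"
  shows "well_poised_faces (keys f)"
proof -
  have irred: "irreducible (initial_form w f)" if "card (face w (keys f)) \<ge> 2" for w
    using assms that by (simp add: well_poised_def keys_initial_form)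
  show ?thesis
    unfolding well_poised_faces_def
  proof (intro conjI allI ballI impI)
    fix w :: "real ^ 'n" and j assume *: "card (face w (keys f)) \<ge> 2"
    show "\<exists>a\<in>face w (keys f). lookup a j = 0"
      using irreducible_avoids_variable[OF irred[OF *], of j] * by (simp add: keys_initial_form)
  next
    fix w :: "real ^ 'n" and p q
    assume pq: "p \<in> face w (keys f)" "q \<in> face w (keys f)" "p \<noteq> q" "keys p \<inter> keys q = {}"
      and segment: "\<forall>b\<in>face w (keys f). \<exists>t\<in>{0..1}.
        exponent_vector b = (1 - t) *\<^sub>R exponent_vector p + t *\<^sub>R exponent_vector q"
    have "finite (face w (keys f))"
      using face_subset finite_keys by (rule finite_subset)
    hence "card {p, q} \<le> card (face w (keys f))"
      using pq by (intro card_mono) auto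
    hence "irreducible (initial_form w f)"
      using pq(3) by (intro irred) simp
    thus "gcd_expvec p q = 1"
      using pq segment by (intro irreducible_segment_gcd) (auto simp: keys_initial_form)
  qed
qed

text \<open>For the backward direction, disjointness and coprimality pass to subsets of the
  exponents, so every initial form inherits them.\<close>

lemma well_poised_iff_coprime_disjoint:
  fixes f :: "('n::finite, 'k::alg_closed_field) mpoly"
  shows "well_poised f \<longleftrightarrow> coprime_disjoint (keys f)"
proof
  assume "well_poised f"
  thus "coprime_disjoint (keys f)"
    by (intro coprime_disjoint_if_well_poised_faces well_poised_faces_keys) auto
next
  assume *: "coprime_disjoint (keys f)"
  show "well_poised f"
    unfolding well_poised_def
  proof (intro allI impI)
    fix w :: "real ^ 'n"
    assume two: "card (keys (initial_form w f)) \<ge> 2"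
    have "keys (initial_form w f) \<subseteq> keys f"
      using face_subset by (simp add: keys_initial_form)
    hence "coprime_disjoint (keys (initial_form w f))"
      using * unfolding coprime_disjoint_def by blast
    with two show "irreducible (initial_form w f)"
      by (intro irreducible_if_coprime_disjoint)
        (auto simp: coprime_disjoint_def disjointly_supported_def)
  qed
qed

theorem theorem1p1:
  fixes f :: "('n::finite, 'k::alg_closed_field) mpoly"
    and I :: "'i set" and c :: "'i \<Rightarrow> 'k" and a :: "'i \<Rightarrow> 'n expvec"
  assumes "f \<noteq> 0"
    and "finite I"
    and "\<And>i. i \<in> I \<Longrightarrow> c i \<noteq> 0"
    and "inj_on a I"
    and "f = (\<Sum>i\<in>I. Poly_Mapping.single (a i) (c i))"
  shows "well_poised f \<longleftrightarrow>
    disjointly_supported f \<and> (\<forall>i\<in>I. \<forall>j\<in>I. i \<noteq> j \<longrightarrow> gcd_expvec (a i) (a j) = 1)"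
proof -
  have lookup: "lookup f b = (\<Sum>i\<in>I. if a i = b then c i else 0)" for b
    by (simp add: assms(5) lookup_sum lookup_single when_def)
  have "a i \<in> keys f" if i: "i \<in> I" for i
  proof -
    \<comment> \<open>Injectivity of \<open>a\<close> keeps the terms from merging, so no
      coefficient cancels.\<close>
    have "lookup f (a i) = (\<Sum>k\<in>I. if k = i then c k else 0)"
      unfolding lookup using assms(4) i by (intro sum.cong) (auto dest: inj_onD)
    thus ?thesis using i assms(2,3) by (simp add: in_keys_iff)
  qed
  moreover have "b \<in> a ` I" if "b \<in> keys f" for b
  proof (rule ccontr)
    assume "b \<notin> a ` I"
    hence "lookup f b = 0"
      unfolding lookup by (intro sum.neutral) auto
    with that show False by (simp add: in_keys_iff)
  qed
  ultimately have keys: "keys f = a ` I" by blast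
  have "well_poised f \<longleftrightarrow> disjointly_supported f \<and>
      (\<forall>b\<in>keys f. \<forall>b'\<in>keys f. b \<noteq> b' \<longrightarrow> gcd_expvec b b' = 1)"
    unfolding well_poised_iff_coprime_disjoint coprime_disjoint_def disjointly_supported_def
    by blast
  also have "(\<forall>b\<in>keys f. \<forall>b'\<in>keys f. b \<noteq> b' \<longrightarrow> gcd_expvec b b' = 1) \<longleftrightarrow>
      (\<forall>i\<in>I. \<forall>j\<in>I. i \<noteq> j \<longrightarrow> gcd_expvec (a i) (a j) = 1)"
    unfolding keys using assms(4) by (auto dest: inj_onD)
  finally show ?thesis .
qed

end
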